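(* Every graph $G$ admits an isoarithmetic integer additive set-indexer.
   Context: All graphs are simple and finite with no isolated vertices. Let $\mathbb{N}_0$ be the set of non-negative integers and $\mathcal{P}(\mathbb{N}_0)$ its power set; all sets used as labels are finite and non-empty. For sets $A,B$, the sum set is $A+B=\{a+b: a\in A, b\in B\}$. An integer additive set-indexer (IASI) of $G$ is an injective map $f:V(G)\to\mathcal{P}(\mathbb{N}_0)$ such that the induced map $f^+:E(G)\to\mathcal{P}(\mathbb{N}_0)$, $f^+(uv)=f(u)+f(v)$, is also injective. An AP-set is a finite set of integers with at least three elements whose elements form an arithmetic progression; its common difference is called the deterministic index of the element (vertex or edge) it labels. An IASI $f$ is arithmetic if $f(v)$ is an AP-set for every vertex $v$ and $f^+(e)$ is an AP-set for every edge $e$. An arithmetic IASI is isoarithmetic if all vertices and edges of $G$ have the same deterministic index. *)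

theory Defs
  imports Main "HOL-Library.Set_Algebras"
begin

text \<open>
  A graph is given by a vertex set and a set of edges, an edge being the two-element set of its
  endpoints; this excludes loops and multiple edges. Isolated vertices are excluded throughout.
\<close>

locale simple_graph =
  fixes V :: "'a set" and E :: "'a set set"
  assumes finite_vertices: "finite V"
    and edges: "\<And>e. e \<in> E \<Longrightarrow> e \<subseteq> V \<and> card e = 2"
    and no_isolated_vertices: "\<And>v. v \<in> V \<Longrightarrow> \<exists>e\<in>E. v \<in> e"

text \<open>
  Addition of sets is the sum set \<open>A + B = {a + b | a \<in> A, b \<in> B}\<close> of \<open>Set_Algebras\<close>. Summing the
  labels over the endpoints of an edge makes the induced map well defined on unordered pairs.
\<close>

definition induced_edge_map :: "('a \<Rightarrow> nat set) \<Rightarrow> 'a set \<Rightarrow> nat set"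
  where "induced_edge_map f e = (\<Sum>v\<in>e. f v)"

lemma induced_edge_map_edge:
  assumes "u \<noteq> v"
  shows "induced_edge_map f {u, v} = f u + f v"
  using assms by (simp add: induced_edge_map_def)

definition iasi :: "'a set \<Rightarrow> 'a set set \<Rightarrow> ('a \<Rightarrow> nat set) \<Rightarrow> bool"
  where "iasi V E f \<longleftrightarrow>
    (\<forall>v\<in>V. finite (f v) \<and> f v \<noteq> {}) \<and>
    inj_on f V \<and> inj_on (induced_edge_map f) E"

definition has_common_difference :: "nat \<Rightarrow> nat set \<Rightarrow> bool"
  where "has_common_difference d A \<longleftrightarrow> (\<exists>a. A = (\<lambda>i. a + i * d) ` {..<card A})"

definition ap_set :: "nat set \<Rightarrow> bool"
  where "ap_set A \<longleftrightarrow> finite A \<and> card A \<ge> 3 \<and> (\<exists>d. has_common_difference d A)"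

text \<open>
  The common difference is that of the increasing enumeration. It is unique, and positive, on AP-sets;
  on other sets the value is irrelevant.
\<close>

definition deterministic_index :: "nat set \<Rightarrow> nat"
  where "deterministic_index A = (THE d. has_common_difference d A)"

lemma has_common_difference_step:
  assumes "card A \<ge> 3" "has_common_difference d A"
  shows "Min A + d \<in> A" "\<And>x. x \<in> A \<Longrightarrow> x \<noteq> Min A \<Longrightarrow> Min A + d \<le> x" "d > 0"
proof -
  from assms(2) obtain a where A: "A = (\<lambda>i. a + i * d) ` {..<card A}"
    unfolding has_common_difference_def by blast
  have elem: "x \<in> A \<longleftrightarrow> (\<exists>i<card A. x = a + i * d)" for x
    by (subst A) auto
  have fin: "finite A"
    using assms(1) card.infinite[of A] by fastforce
  have Min: "Min A = a"
  proof (rule Min_eqI[OF fin])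
    show "a \<le> y" if "y \<in> A" for y using that elem by auto
    show "a \<in> A" unfolding elem using assms(1) by (intro exI[of _ 0]) simp
  qed
  show "Min A + d \<in> A"
    unfolding Min elem using assms(1) by (intro exI[of _ 1]) simp
  show "Min A + d \<le> x" if "x \<in> A" "x \<noteq> Min A" for x
  proof -
    from that obtain i where "x = a + i * d" "i \<noteq> 0"
      unfolding Min elem by fastforce
    then show ?thesis unfolding Min by (cases i) auto
  qed
  show "d > 0"
  proof (rule ccontr)
    assume "\<not> d > 0"
    then have "A \<subseteq> {a}" using elem by auto
    then have "card A \<le> 1" using card_mono[of "{a}" A] by simp
    with assms(1) show False by simp
  qed
qed

lemma has_common_difference_unique:
  assumes "card A \<ge> 3" "has_common_difference d A" "has_common_difference d' A"
  shows "d = d'"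
proof (rule antisym)
  note s = has_common_difference_step[OF assms(1,2)]
  note s' = has_common_difference_step[OF assms(1,3)]
  show "d \<le> d'" using s(2)[OF s'(1)] s'(3) by simp
  show "d' \<le> d" using s'(2)[OF s(1)] s(3) by simp
qed

lemma deterministic_index_eqI:
  assumes "card A \<ge> 3" "has_common_difference d A"
  shows "deterministic_index A = d"
  unfolding deterministic_index_def
  using assms has_common_difference_unique by blast

definition arithmetic_iasi :: "'a set \<Rightarrow> 'a set set \<Rightarrow> ('a \<Rightarrow> nat set) \<Rightarrow> bool"
  where "arithmetic_iasi V E f \<longleftrightarrow>
    iasi V E f \<and> (\<forall>v\<in>V. ap_set (f v)) \<and> (\<forall>e\<in>E. ap_set (induced_edge_map f e))"

definition isoarithmetic_iasi :: "'a set \<Rightarrow> 'a set set \<Rightarrow> ('a \<Rightarrow> nat set) \<Rightarrow> bool"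
  where "isoarithmetic_iasi V E f \<longleftrightarrow>
    arithmetic_iasi V E f \<and>
    (\<exists>d. (\<forall>v\<in>V. deterministic_index (f v) = d) \<and>
         (\<forall>e\<in>E. deterministic_index (induced_edge_map f e) = d))"

end

theory Submission
  imports Defs "HOL-Library.Nat_Bijection"
begin

text \<open>
  Label the vertices by intervals of three consecutive integers whose left endpoints are distinct
  powers of 2. The label of an edge is then an interval of five integers whose left endpoint is a sum
  of two distinct powers of 2, and by uniqueness of binary expansions this sum determines the edge.
\<close>

lemma atLeastAtMost_plus_atLeastAtMost_nat:
  fixes a b m n :: nat
  shows "{a..a + m} + {b..b + n} = {a + b..a + b + (m + n)}"
proof (intro equalityI subsetI)
  fix x assume "x \<in> {a..a + m} + {b..b + n}"
  then show "x \<in> {a + b..a + b + (m + n)}"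
    by (auto elim!: set_plus_elim)
next
  fix x assume x: "x \<in> {a + b..a + b + (m + n)}"
  \<comment> \<open>Greedy splitting: the first summand is as large as possible, so the second is
    \<open>b\<close> unless the first is capped at \<open>a + m\<close>. As
    \<open>x \<ge> a + b\<close>, the truncated subtraction \<open>x - b\<close> is exact and at
    least \<open>a\<close>.\<close>
  define y where "y = min (x - b) (a + m)"
  have "y \<in> {a..a + m}" "x - y \<in> {b..b + n}" "x = y + (x - y)"
    using x by (auto simp: y_def min_def)
  then show "x \<in> {a..a + m} + {b..b + n}"
    by (metis set_plus_intro)
qed

lemma has_common_difference_atLeastAtMost: "has_common_difference 1 {a..a + n}"
proof -
  have "{a..a + n} = (+) a ` {..<Suc n}"
    using image_add_atLeastAtMost[of a 0 n]
    by (simp add: atLeast0AtMost lessThan_Suc_atMost add.commute)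
  then show ?thesis
    unfolding has_common_difference_def by (intro exI[of _ a]) (simp add: card_image)
qed

lemma ap_set_atLeastAtMost:
  assumes "n \<ge> 2"
  shows "ap_set {a..a + n}"
  using assms has_common_difference_atLeastAtMost unfolding ap_set_def by auto

lemma deterministic_index_atLeastAtMost:
  assumes "n \<ge> 2"
  shows "deterministic_index {a..a + n} = 1"
  using assms by (intro deterministic_index_eqI has_common_difference_atLeastAtMost) simp

theorem theorem2p3:
  fixes V :: "'a set" and E :: "'a set set"
  assumes "simple_graph V E"
  shows "\<exists>f :: 'a \<Rightarrow> nat set. isoarithmetic_iasi V E f"
proof -
  interpret simple_graph V E by fact
  obtain h :: "'a \<Rightarrow> nat" where h: "inj_on h V"
    using finite_imp_inj_to_nat_seg[OF finite_vertices] by blast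
  define f :: "'a \<Rightarrow> nat set" where "f v = {2 ^ h v..2 ^ h v + 2}" for v
  \<comment> \<open>\<open>set_encode\<close> sums \<open>2 ^ i\<close> over a set, so it yields the
    left endpoint in a form that depends on the unordered edge only.\<close>
  have edge: "induced_edge_map f e = {set_encode (h ` e)..set_encode (h ` e) + 4}"
    if "e \<in> E" for e
  proof -
    from edges[OF that] obtain u v where e: "e = {u, v}" "u \<noteq> v" "u \<in> V" "v \<in> V"
      by (auto simp: card_2_iff)
    then have "h u \<noteq> h v"
      using h by (auto dest: inj_onD)
    then show ?thesis
      using e atLeastAtMost_plus_atLeastAtMost_nat[of "2 ^ h u" 2 "2 ^ h v" 2]
      by (simp add: induced_edge_map_edge f_def set_encode_def)
  qed
  have "inj_on f V"
    using h by (auto simp: inj_on_def f_def)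
  moreover have "inj_on (induced_edge_map f) E"
  proof (rule inj_onI)
    fix e e' assume E: "e \<in> E" "e' \<in> E" and "induced_edge_map f e = induced_edge_map f e'"
    then have "set_encode (h ` e) = set_encode (h ` e')"
      by (simp add: edge)
    moreover have "e \<subseteq> V" "e' \<subseteq> V"
      using E edges by auto
    moreover from this have "finite e" "finite e'"
      using finite_vertices finite_subset by auto
    \<comment> \<open>Uniqueness of binary expansions is \<open>set_encode_eq\<close>, which holds
      for finite sets; injectivity of \<open>h\<close> on \<open>V\<close> then recovers the
      edge.\<close>
    ultimately show "e = e'"
      using h by (simp add: set_encode_eq inj_on_image_eq_iff)
  qed
  ultimately have "iasi V E f"
    by (simp add: iasi_def f_def)
  then have "isoarithmetic_iasi V E f"
    unfolding isoarithmetic_iasi_def arithmetic_iasi_def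
    \<comment> \<open>The deleted rules would turn \<open>+ 2\<close> into nested
      \<open>Suc\<close>, and the interval lemmas would no longer match.\<close>
    by (auto simp: edge f_def ap_set_atLeastAtMost deterministic_index_atLeastAtMost
        simp del: add_2_eq_Suc add_2_eq_Suc')
  then show ?thesis by blast
qed

end
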